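(* There is no simple involution of length $n>2$ that avoids the pattern $3412$.
   Context: A permutation $\pi\in S_n$ avoids a pattern $s\in S_k$ if no subsequence of $\pi$ is order-isomorphic to $s$. An involution is a permutation equal to its own inverse. An interval of $\pi\in S_n$ is a set of contiguous positions $[a,b]$ whose image $\{\pi(i):a\le i\le b\}$ is a set of contiguous integers; $\pi$ is simple if its only intervals are the empty set, singletons and $[1,n]$. *)

theory Defs
  imports "HOL-Combinatorics.Permutations"
begin

text \<open>
  An element of \<open>S\<^sub>n\<close> is a function \<open>\<pi>\<close> with \<open>\<pi> permutes {1..n}\<close>. Positions and values are
  numbered from 1.
\<close>

definition order_isomorphic_at ::
    "(nat \<Rightarrow> nat) \<Rightarrow> (nat \<Rightarrow> nat) \<Rightarrow> nat \<Rightarrow> (nat \<Rightarrow> nat) \<Rightarrow> bool" where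
  "order_isomorphic_at \<pi> f k s \<longleftrightarrow>
     (\<forall>i\<in>{1..k}. \<forall>j\<in>{1..k}. \<pi> (f i) < \<pi> (f j) \<longleftrightarrow> s i < s j)"

text \<open>
  The subsequence of \<open>\<pi> \<in> S\<^sub>n\<close> is given by its increasing sequence of positions
  \<open>f 1 < \<dots> < f k\<close>; the pattern is \<open>s \<in> S\<^sub>k\<close>.
\<close>

definition avoids :: "nat \<Rightarrow> (nat \<Rightarrow> nat) \<Rightarrow> nat \<Rightarrow> (nat \<Rightarrow> nat) \<Rightarrow> bool" where
  "avoids n \<pi> k s \<longleftrightarrow>
     \<not> (\<exists>f. strict_mono_on {1..k} f \<and> f ` {1..k} \<subseteq> {1..n} \<and> order_isomorphic_at \<pi> f k s)"

definition one_line :: "nat list \<Rightarrow> nat \<Rightarrow> nat" where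
  "one_line w i = (if i \<in> {1..length w} then w ! (i - 1) else i)"

definition involution :: "(nat \<Rightarrow> nat) \<Rightarrow> bool" where
  "involution \<pi> \<longleftrightarrow> inv \<pi> = \<pi>"

text \<open>The empty set is contiguous: take \<open>b < a\<close>.\<close>

definition contiguous :: "nat set \<Rightarrow> bool" where
  "contiguous A \<longleftrightarrow> (\<exists>a b. A = {a..b})"

definition perm_interval :: "nat \<Rightarrow> (nat \<Rightarrow> nat) \<Rightarrow> nat set \<Rightarrow> bool" where
  "perm_interval n \<pi> A \<longleftrightarrow> A \<subseteq> {1..n} \<and> contiguous A \<and> contiguous (\<pi> ` A)"

definition simple_perm :: "nat \<Rightarrow> (nat \<Rightarrow> nat) \<Rightarrow> bool" where
  "simple_perm n \<pi> \<longleftrightarrow>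
     (\<forall>A. perm_interval n \<pi> A \<longrightarrow> A = {} \<or> (\<exists>a. A = {a}) \<or> A = {1..n})"

end

theory Submission
  imports Defs
begin

text \<open>
  Draw an involution as arcs joining \<open>i\<close> and \<open>\<pi> i\<close>. Two crossing arcs form a \<open>3412\<close>, so in
  an avoiding involution the arc at 1 isolates the positions below it: \<open>{1..\<pi> 1}\<close> is mapped to
  itself. This is a proper interval if \<open>1 < \<pi> 1 < n\<close>. If \<open>\<pi> 1 = 1\<close> or \<open>\<pi> 1 = n\<close>, the
  complement \<open>{2..n}\<close> or \<open>{2..n-1}\<close> of the arc at 1 is invariant instead; it is too small to
  contradict simplicity only for \<open>321\<close>, where \<open>{1,2}\<close> is an interval.
\<close>

lemma avoids_3412_no_crossing:
  assumes "avoids n \<pi> 4 (one_line [3, 4, 1, 2])"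
    and \<pi>: "\<And>x. \<pi> (\<pi> x) = x"
    and "1 \<le> i" "i < j" "j < \<pi> i" "\<pi> i < \<pi> j" "\<pi> j \<le> n"
  shows False
proof -
  \<comment> \<open>\<open>f\<close> lists the four endpoints of the crossing arcs in increasing
    order. Since \<open>\<pi>\<close> swaps the ends of each arc, the values there are
    \<open>\<pi> i\<close>, \<open>\<pi> j\<close>, \<open>i\<close>, \<open>j\<close>, in the
    relative order 3412.\<close>
  define f where "f = (\<lambda>x::nat. if x = 1 then i else if x = 2 then j else if x = 3 then \<pi> i else \<pi> j)"
  have four: "{1..4::nat} = {1, 2, 3, 4}" by auto
  have "strict_mono_on {1..4} f"
    using assms(4-6) unfolding strict_mono_on_def four by (auto simp: f_def)
  moreover have "f ` {1..4} \<subseteq> {1..n}"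
    using assms(3-7) unfolding four by (auto simp: f_def)
  moreover have "order_isomorphic_at \<pi> f 4 (one_line [3, 4, 1, 2])"
    using assms(4-6) unfolding order_isomorphic_at_def four
    by (auto simp: f_def \<pi> one_line_def)
  ultimately show False
    using assms(1) unfolding avoids_def by blast
qed

text \<open>An injective self-map of a finite set is onto, so an invariant block is its own image
  and hence an interval; \<open>a < b\<close> rules out a singleton.\<close>

lemma simple_perm_invariant_interval:
  assumes "\<pi> permutes {1..n}" "simple_perm n \<pi>" "1 \<le> a" "a < b" "b \<le> n"
    and "\<And>x. x \<in> {a..b} \<Longrightarrow> \<pi> x \<in> {a..b}"
  shows "a = 1 \<and> b = n"
proof -
  have "\<pi> ` {a..b} = {a..b}"
    using assms(6) permutes_inj_on[OF assms(1)] by (intro endo_inj_surj) auto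
  then have "perm_interval n \<pi> {a..b}"
    using assms(3,5) by (auto simp: perm_interval_def contiguous_def)
  then have "{a..b} = {} \<or> (\<exists>c. {a..b} = {c}) \<or> {a..b} = {1..n}"
    using assms(2) unfolding simple_perm_def by blast
  moreover have "\<not> (\<exists>c. {a..b} = {c})"
    using assms(4) by (metis atLeastAtMost_singleton_iff less_irrefl)
  ultimately show ?thesis
    using assms(4) by (auto simp: Icc_eq_Icc)
qed

theorem theorem5p3:
  fixes n :: nat
  assumes "n > 2"
  shows "\<not> (\<exists>\<pi>. \<pi> permutes {1..n} \<and> simple_perm n \<pi> \<and> involution \<pi> \<and>
                avoids n \<pi> 4 (one_line [3, 4, 1, 2]))"
proof
  assume "\<exists>\<pi>. \<pi> permutes {1..n} \<and> simple_perm n \<pi> \<and> involution \<pi> \<and>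
                avoids n \<pi> 4 (one_line [3, 4, 1, 2])"
  then obtain \<pi> where perm: "\<pi> permutes {1..n}" and simple: "simple_perm n \<pi>"
    and "involution \<pi>" and avoids: "avoids n \<pi> 4 (one_line [3, 4, 1, 2])"
    by blast
  then have invol: "\<pi> (\<pi> x) = x" for x
    unfolding involution_def by (metis permutes_inverses(1))
  have range: "1 \<le> \<pi> x \<and> \<pi> x \<le> n" if "1 \<le> x" "x \<le> n" for x
    using permutes_in_image[OF perm, of x] that by auto
  consider "\<pi> 1 = 1" | "1 < \<pi> 1" "\<pi> 1 < n" | "\<pi> 1 = n"
    using range[of 1] assms by linarith
  then show False
  proof cases
    case 1
    have "\<pi> x \<in> {2..n}" if "x \<in> {2..n}" for x
    proof -
      have "\<pi> x \<noteq> 1" using 1 invol[of x] that by auto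
      then show ?thesis using range[of x] that by auto
    qed
    then show False
      using simple_perm_invariant_interval[OF perm simple, of 2 n] assms by auto
  next
    case 2
    have "\<pi> x \<in> {1..\<pi> 1}" if "x \<in> {1..\<pi> 1}" for x
    proof (cases "x = 1 \<or> x = \<pi> 1")
      case True
      then show ?thesis using 2 invol by auto
    next
      case False
      \<comment> \<open>If \<open>\<pi> x\<close> exceeded \<open>\<pi> 1\<close>, then
        \<open>1 < x < \<pi> 1 < \<pi> x\<close> and the arcs at 1 and \<open>x\<close> would
        cross.\<close>
      then show ?thesis
        using avoids_3412_no_crossing[OF avoids invol, of 1 x] range[of x] that 2
        by (auto simp: not_less[symmetric])
    qed
    then show False
      using simple_perm_invariant_interval[OF perm simple, of 1 "\<pi> 1"] 2 by auto
  next
    case 3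
    then have "\<pi> n = 1" using invol[of 1] by simp
    have inner: "\<pi> x \<in> {2..n - 1}" if "x \<in> {2..n - 1}" for x
    proof -
      have "\<pi> x \<noteq> 1" "\<pi> x \<noteq> n"
        using 3 \<open>\<pi> n = 1\<close> invol[of x] that by auto
      moreover have "1 \<le> \<pi> x \<and> \<pi> x \<le> n" using that by (intro range) auto
      ultimately have "2 \<le> \<pi> x \<and> \<pi> x \<le> n - 1" by linarith
      then show ?thesis by simp
    qed
    show False
    proof (cases "n = 3")
      case True
      \<comment> \<open>The inner block is the single point 2, so an interval that is moved rather
        than fixed is needed: \<open>{1..2}\<close> goes to \<open>{2..3}\<close>.\<close>
      then have "\<pi> 2 = 2" using inner[of 2] by auto
      then have "\<pi> ` {1..2} = {2..3}"
        using 3 True by (auto simp: numeral_2_eq_2 numeral_3_eq_3 atLeastAtMostSuc_conv)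
      then have "perm_interval n \<pi> {1..2}"
        using True by (auto simp: perm_interval_def contiguous_def)
      then have "{1..2::nat} = {} \<or> (\<exists>c. {1..2::nat} = {c}) \<or> {1..2} = {1..n}"
        using simple unfolding simple_perm_def by blast
      then show False
        using True by (auto simp: Icc_eq_Icc atLeastAtMost_singleton_iff)
    next
      case False
      \<comment> \<open>Now the inner block has at least two points.\<close>
      then have "2 < n - 1" using assms by linarith
      then show False
        using simple_perm_invariant_interval[OF perm simple, of 2 "n - 1"] inner by simp
    qed
  qed
qed

end
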